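(* Let $D=V_1\cdots V_n$ be a discrete conic with $n$ sides, lying on a conic $C$ with focus $F$. If $n$ is even then the diagonals $V_jV_{j+\frac{n}{2}}$ of $D$ are coincident at $F$ (all pass through $F$). If $n$ is odd then the chords $V_jM_{j+\frac{n-1}{2}}$ are coincident at $F$.
   Context: Let $C$ be a conic with focus $F$. A discrete conic (on $C$) is a polygon $V_1V_2\cdots V_n$ with vertices on $C$ such that, for some fixed $\theta\in\mathbb{R}$, $\angle V_iFV_{i+1}=\theta$ for every $i\in\{1,2,\ldots,n\}$. When $C$ is a hyperbola, a parabola or a degenerate conic, the rays used in measuring an angle are allowed to wrap around the plane. The sides $S_i=V_iV_{i+1}$ of a discrete conic are tangent to a conic with focus $F$, denoted $C_L$, and $M_i=V_iV_{i+1}\cap C_L$ denotes the point of tangency of $S_i$ with $C_L$. *)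

theory Defs
  imports "HOL-Analysis.Analysis"
begin

text \<open>The plane is \<^typ>\<open>complex\<close>. A conic with focus \<open>F\<close> is given by its eccentricity vector
  \<open>a\<close> (of length the eccentricity, orthogonal to the directrix) and its semi-latus rectum
  \<open>l \<ge> 0\<close>; the directrix is \<open>{P. a \<bullet> (P - F) = l}\<close>. For \<open>a = 0\<close> this is the circle of radius
  \<open>l\<close> about \<open>F\<close>; for \<open>l = 0\<close> the focus lies on the directrix and the conic is degenerate
  (a point, a line or two lines through \<open>F\<close>).\<close>

definition conic :: "complex \<Rightarrow> complex \<Rightarrow> real \<Rightarrow> complex set" where
  "conic F a l = {P. dist P F = \<bar>l - a \<bullet> (P - F)\<bar>}"

definition directrix :: "complex \<Rightarrow> complex \<Rightarrow> real \<Rightarrow> complex set" where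
  "directrix F a l = {P. a \<bullet> (P - F) = l}"

lemma conic_circle: "0 \<le> l \<Longrightarrow> conic F 0 l = sphere F l"
  by (auto simp: conic_def dist_commute)

lemma conic_focus_directrix:
  assumes "a \<noteq> 0"
  shows "conic F a l = {P. dist P F = norm a * infdist P (directrix F a l)}"
proof -
  have "norm a * infdist P (directrix F a l) = \<bar>l - a \<bullet> (P - F)\<bar>" for P
  proof -
    define s where "s = l - a \<bullet> (P - F)"
    define Q where "Q = P + (s / (norm a)\<^sup>2) *\<^sub>R a"
    have na: "norm a > 0" using assms by simp
    have "a \<bullet> (Q - F) = a \<bullet> (P - F) + (s / (norm a)\<^sup>2) * (a \<bullet> a)"
      by (simp add: Q_def inner_diff_right inner_add_right)
    also have "\<dots> = l"
      using na by (simp add: s_def power2_norm_eq_inner[symmetric])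
    finally have Q: "Q \<in> directrix F a l" by (simp add: directrix_def)
    have dQ: "dist P Q = \<bar>s\<bar> / norm a"
      using na by (simp add: Q_def dist_norm power2_eq_square)
    have "\<bar>s\<bar> / norm a \<le> dist P X" if "X \<in> directrix F a l" for X
    proof -
      have "s = a \<bullet> (X - P)"
        using that by (simp add: directrix_def s_def inner_diff_right)
      then have "\<bar>s\<bar> \<le> norm a * dist P X"
        using Cauchy_Schwarz_ineq2[of a "X - P"] by (simp add: dist_norm norm_minus_commute)
      then show ?thesis using na by (simp add: field_simps)
    qed
    then have "\<bar>s\<bar> / norm a \<le> infdist P (directrix F a l)"
      using Q by (subst infdist_notempty) (auto intro!: cINF_greatest)
    moreover have "infdist P (directrix F a l) \<le> \<bar>s\<bar> / norm a"
      using infdist_le[OF Q, of P] dQ by simp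
    ultimately show ?thesis using na by (simp add: s_def field_simps)
  qed
  then show ?thesis by (simp add: conic_def)
qed

text \<open>\<open>u\<close> is the direction of the ray from \<open>F\<close> to the point \<open>V\<close> of the conic. A ray that wraps
  around the plane leaves \<open>F\<close> in direction \<open>u\<close>, passes through infinity and reaches \<open>V\<close> from the
  opposite side, so that \<open>V = F + r *\<^sub>R u\<close> with \<open>r < 0\<close>. For \<open>l > 0\<close> this is the ray used exactly
  when the directrix separates \<open>V\<close> from \<open>F\<close>, that is, on the second branch of a hyperbola:
  then \<open>r\<close> is the value of the polar equation \<open>r = l / (1 + a \<bullet> u)\<close>, and \<open>V\<close> is the first point
  of the conic on the ray. On a degenerate conic both rays are admitted.\<close>

definition focal_direction :: "complex \<Rightarrow> complex \<Rightarrow> real \<Rightarrow> complex \<Rightarrow> complex \<Rightarrow> bool" where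
  "focal_direction F a l V u \<longleftrightarrow> norm u = 1 \<and>
     (\<exists>r. r \<noteq> 0 \<and> V = F + r *\<^sub>R u \<and> (l = 0 \<or> (0 < r \<longleftrightarrow> a \<bullet> (V - F) < l)))"

text \<open>Indices are cyclic modulo \<open>n\<close>, and each vertex has one ray, used for both angles there.\<close>

definition discrete_conic :: "complex \<Rightarrow> complex \<Rightarrow> real \<Rightarrow> nat \<Rightarrow> (nat \<Rightarrow> complex) \<Rightarrow> bool" where
  "discrete_conic F a l n V \<longleftrightarrow>
     3 \<le> n \<and> 0 \<le> l \<and> (\<forall>i. V (i + n) = V i) \<and> inj_on V {..<n} \<and> (\<forall>i. V i \<in> conic F a l) \<and>
     (\<exists>(\<theta>::real) u. \<forall>i. u (i + n) = u i \<and> focal_direction F a l (V i) (u i) \<and>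
        u (i + 1) = cis \<theta> * u i)"

definition side :: "(nat \<Rightarrow> complex) \<Rightarrow> nat \<Rightarrow> complex set" where
  "side V i = affine hull {V i, V (i + 1)}"

definition conic_form :: "complex \<Rightarrow> complex \<Rightarrow> real \<Rightarrow> complex \<Rightarrow> real" where
  "conic_form F a l P = (dist P F)\<^sup>2 - (l - a \<bullet> (P - F))\<^sup>2"

lemma conic_eq_zeros: "conic F a l = {P. conic_form F a l P = 0}"
  by (auto simp: conic_def conic_form_def) (metis abs_of_nonneg power2_eq_iff_nonneg
      power2_abs zero_le_dist abs_ge_zero)

text \<open>Tangency is intersection with multiplicity two: on the line \<open>L\<close> the quadratic equation of
  the conic has a double root, either at a point \<open>M\<close> of the plane or at infinity. In the
  latter case \<open>L\<close> is an asymptote.\<close>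

definition tangent_at :: "complex \<Rightarrow> complex \<Rightarrow> real \<Rightarrow> complex set \<Rightarrow> complex \<Rightarrow> bool" where
  "tangent_at F a l L M \<longleftrightarrow>
     M \<in> L \<and> (\<exists>c. c \<noteq> 0 \<and> (\<forall>P\<in>L. conic_form F a l P = c * (dist P M)\<^sup>2))"

definition tangent_at_infinity :: "complex \<Rightarrow> complex \<Rightarrow> real \<Rightarrow> complex set \<Rightarrow> bool" where
  "tangent_at_infinity F a l L \<longleftrightarrow> (\<exists>c. c \<noteq> 0 \<and> (\<forall>P\<in>L. conic_form F a l P = c))"

definition tangent_line :: "complex \<Rightarrow> complex \<Rightarrow> real \<Rightarrow> complex set \<Rightarrow> bool" where
  "tangent_line F a l L \<longleftrightarrow> (\<exists>M. tangent_at F a l L M) \<or> tangent_at_infinity F a l L"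

end

theory Submission
  imports Defs
begin

text \<open>Let \<open>l > 0\<close> and let \<open>u i\<close> be the ray directions, so \<open>V i - F = r *\<^sub>R u i\<close> with
  \<open>r * (1 + a \<bullet> u i) = l\<close>. Polarity about \<open>F\<close> turns conics with focus \<open>F\<close> into circles: a line
  \<open>q \<bullet> (P - F) = 1\<close> is tangent to the conic \<open>(b, m)\<close> iff \<open>e = m *\<^sub>R q - b\<close> is a unit vector, and
  then \<open>e\<close> is the direction of the point of tangency. If \<open>n\<close> is odd, the side opposite to \<open>V j\<close>
  has pole \<open>q = (a + \<kappa> *\<^sub>R u j) /\<^sub>R l\<close> with \<open>\<kappa>\<close> independent of \<open>j\<close>. These poles lie on a circle
  with centre \<open>a /\<^sub>R l\<close>, and three of them determine it, so \<open>e\<close> is parallel to \<open>u j\<close>.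
  If \<open>n\<close> is even, \<open>u (j + n div 2) = \<plusminus> u j\<close>.\<close>

section \<open>Lines and bases in the plane\<close>

lemma affine_hull_2_collinear:
  fixes F u :: "'a::real_vector"
  assumes "r \<noteq> s"
  shows "F + t *\<^sub>R u \<in> affine hull {F + r *\<^sub>R u, F + s *\<^sub>R u}"
proof -
  define p where "p = (s - t) / (s - r)"
  have "p * (s - r) = s - t" using assms by (simp add: p_def)
  then have "p * r + (1 - p) * s = t" by (simp add: algebra_simps)
  then have "F + t *\<^sub>R u = p *\<^sub>R (F + r *\<^sub>R u) + (1 - p) *\<^sub>R (F + s *\<^sub>R u)"
    by (simp add: algebra_simps flip: scaleR_add_left)
  then show ?thesis unfolding affine_hull_2 by force
qed

lemma affine_hull_2_translate:
  assumes "P \<in> affine hull {x, y}"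
  shows "P + s *\<^sub>R (y - x) \<in> affine hull {x, y}"
proof -
  obtain p q where "P = p *\<^sub>R x + q *\<^sub>R y" "p + q = 1"
    using assms by (auto simp: affine_hull_2)
  then have "P + s *\<^sub>R (y - x) = (p - s) *\<^sub>R x + (q + s) *\<^sub>R y" "(p - s) + (q + s) = 1"
    by (auto simp: algebra_simps)
  then show ?thesis unfolding affine_hull_2 by blast
qed

lemma quadratic_vanishes:
  fixes A B C :: real
  assumes "\<And>s. A * s\<^sup>2 + B * s + C = 0"
  shows "A = 0" "B = 0" "C = 0"
  using assms[of 0] assms[of 1] assms[of "-1"] by auto

text \<open>Since \<open>q\<close> annihilates \<open>d\<close> but not \<open>p\<close>, the
  vectors \<open>p\<close> and \<open>d\<close> form a basis. In the tangency lemmas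
  \<open>q\<close> is the pole of a line, \<open>d\<close> its direction and \<open>p\<close> the
  position of a point on it.\<close>

lemma complex_orthogonal_to_basis:
  fixes x p d q :: complex
  assumes "x \<bullet> p = 0" "x \<bullet> d = 0" "q \<bullet> p \<noteq> 0" "q \<bullet> d = 0" "d \<noteq> 0"
  shows "x = 0"
proof -
  \<comment> \<open>\<open>w\<close> is the determinant of \<open>p\<close> and \<open>d\<close>. If
    it vanished, the first pair of identities would force \<open>d = 0\<close>; the last pair is
    Cramer's rule.\<close>
  define w where "w = Re p * Im d - Im p * Re d"
  have w: "w \<noteq> 0"
  proof
    assume "w = 0"
    have "Im d * (q \<bullet> p) = Re q * w + Im p * (q \<bullet> d)" "Re d * (q \<bullet> p) = - Im q * w + Re p * (q \<bullet> d)"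
      by (simp_all add: w_def inner_complex_def algebra_simps)
    then have "Im d = 0" "Re d = 0" using assms \<open>w = 0\<close> by auto
    then show False using assms(5) by (simp add: complex_eq_iff)
  qed
  have "Re x * w = Im d * (x \<bullet> p) - Im p * (x \<bullet> d)" "Im x * w = Re p * (x \<bullet> d) - Re d * (x \<bullet> p)"
    by (simp_all add: w_def inner_complex_def algebra_simps)
  then show ?thesis using assms w by (simp add: complex_eq_iff)
qed

section \<open>Tangency on a line given by its pole\<close>

lemma conic_form_on_polar:
  assumes "q \<bullet> (P - F) = 1"
  shows "conic_form F b m P = (P - F) \<bullet> (P - F) - ((m *\<^sub>R q - b) \<bullet> (P - F))\<^sup>2"
  \<comment> \<open>On the line, \<open>m = m * (q \<bullet> (P - F))\<close>, which makes the form
    homogeneous in \<open>P - F\<close>.\<close>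
  using assms
  by (simp add: conic_form_def dist_norm power2_norm_eq_inner inner_diff_left)

lemma conic_form_on_polar_line:
  assumes "q \<bullet> (P - F) = 1" "q \<bullet> d = 0" and e: "e = m *\<^sub>R q - b"
  shows "conic_form F b m (P + s *\<^sub>R d) =
    (d \<bullet> d - (e \<bullet> d)\<^sup>2) * s\<^sup>2 + 2 * (((P - F) - (e \<bullet> (P - F)) *\<^sub>R e) \<bullet> d) * s
      + ((P - F) \<bullet> (P - F) - (e \<bullet> (P - F))\<^sup>2)"
proof -
  define p where "p = P - F"
  have eq: "P + s *\<^sub>R d - F = p + s *\<^sub>R d" by (simp add: p_def)
  have "q \<bullet> (P + s *\<^sub>R d - F) = 1"
    using assms by (simp add: eq inner_add_right p_def)
  then have "conic_form F b m (P + s *\<^sub>R d) = (p + s *\<^sub>R d) \<bullet> (p + s *\<^sub>R d) - (e \<bullet> (p + s *\<^sub>R d))\<^sup>2"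
    using conic_form_on_polar[of q "P + s *\<^sub>R d" F b m] by (simp add: e eq)
  then show ?thesis
    unfolding p_def[symmetric]
    by (simp add: inner_add_left inner_add_right inner_diff_left inner_commute
        power2_eq_square algebra_simps)
qed

text \<open>A double root at \<open>M\<close> leaves no linear and no constant term in
  \<open>s\<close>. These two coefficients say that \<open>p - k *\<^sub>R e\<close> is orthogonal
  to \<open>d\<close> and to \<open>p\<close>, so it vanishes; the constant term then makes
  \<open>e\<close> a unit vector.\<close>

lemma tangent_at_polar:
  assumes tan: "tangent_at F b m L M"
    and L: "\<And>P. P \<in> L \<Longrightarrow> q \<bullet> (P - F) = 1" "\<And>P s. P \<in> L \<Longrightarrow> P + s *\<^sub>R d \<in> L"
    and d: "d \<noteq> 0" "q \<bullet> d = 0" and e: "e = m *\<^sub>R q - b"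
  obtains k where "M - F = k *\<^sub>R e" "norm e = 1"
proof -
  define p where "p = M - F"
  define k where "k = e \<bullet> p"
  obtain c where M: "M \<in> L" and c: "\<And>P. P \<in> L \<Longrightarrow> conic_form F b m P = c * (dist P M)\<^sup>2"
    using tan by (auto simp: tangent_at_def)
  have qp: "q \<bullet> p = 1" using L(1)[OF M] by (simp add: p_def)
  have "(d \<bullet> d - (e \<bullet> d)\<^sup>2 - c * (d \<bullet> d)) * s\<^sup>2 + 2 * ((p - k *\<^sub>R e) \<bullet> d) * s + (p \<bullet> p - k\<^sup>2) = 0" for s
    using conic_form_on_polar_line[OF L(1)[OF M] d(2) e, of s] c[OF L(2)[OF M, of s]]
    by (simp add: p_def k_def dist_norm power_mult_distrib power2_norm_eq_inner algebra_simps)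
  note * = quadratic_vanishes[OF this]
  have "(p - k *\<^sub>R e) \<bullet> p = 0" using *(3)
    by (simp add: inner_diff_left k_def power2_eq_square)
  with *(2) have "p - k *\<^sub>R e = 0"
    using complex_orthogonal_to_basis[of "p - k *\<^sub>R e" p d q] qp d by simp
  then have pk: "p = k *\<^sub>R e" by simp
  have "k \<noteq> 0" using pk qp by auto
  then have "e \<bullet> e = 1" using *(3) pk by (simp add: power2_eq_square)
  then have "norm e = 1" by (simp add: norm_eq_1)
  then show ?thesis using that[of k] pk by (simp only: p_def)
qed

text \<open>Here the quadratic and the linear coefficients vanish instead, so \<open>p\<close> and
  \<open>d\<close> exchange roles: the line itself is parallel to \<open>e\<close>.\<close>

lemma tangent_at_infinity_polar:
  assumes tan: "tangent_at_infinity F b m L" and P: "P \<in> L"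
    and L: "\<And>P. P \<in> L \<Longrightarrow> q \<bullet> (P - F) = 1" "\<And>P s. P \<in> L \<Longrightarrow> P + s *\<^sub>R d \<in> L"
    and d: "d \<noteq> 0" "q \<bullet> d = 0" and e: "e = m *\<^sub>R q - b"
  obtains k where "d = k *\<^sub>R e" "norm e = 1"
proof -
  define p where "p = P - F"
  define k where "k = e \<bullet> d"
  obtain c where c: "\<And>P. P \<in> L \<Longrightarrow> conic_form F b m P = c"
    using tan by (auto simp: tangent_at_infinity_def)
  have qp: "q \<bullet> p = 1" using L(1)[OF P] by (simp add: p_def)
  have "(d \<bullet> d - k\<^sup>2) * s\<^sup>2 + 2 * ((p - (e \<bullet> p) *\<^sub>R e) \<bullet> d) * s + (p \<bullet> p - (e \<bullet> p)\<^sup>2 - c) = 0" for s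
    using conic_form_on_polar_line[OF L(1)[OF P] d(2) e, of s] c[OF L(2)[OF P, of s]]
    by (simp add: p_def k_def)
  note * = quadratic_vanishes[OF this]
  have "(d - k *\<^sub>R e) \<bullet> d = 0" using *(1)
    by (simp add: inner_diff_left k_def power2_eq_square)
  moreover have "(d - k *\<^sub>R e) \<bullet> p = 0" using *(2)
    by (simp add: inner_diff_left k_def inner_commute algebra_simps)
  ultimately have "d - k *\<^sub>R e = 0"
    using complex_orthogonal_to_basis[of "d - k *\<^sub>R e" p d q] qp d by simp
  then have dk: "d = k *\<^sub>R e" by simp
  have "k \<noteq> 0" using dk d by auto
  then have "e \<bullet> e = 1" using *(1) dk by (simp add: power2_eq_square)
  then have "norm e = 1" by (simp add: norm_eq_1)
  then show ?thesis using that[of k] dk by blast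
qed

text \<open>A line through \<open>F\<close> has no pole and is treated directly: the quadratic on it
  has discriminant \<open>4 * m\<^sup>2 > 0\<close>, and its two leading coefficients cannot both
  vanish.\<close>

lemma tangent_line_avoids_focus:
  assumes "0 < m" and u: "norm u = 1" and L: "\<And>s. F + s *\<^sub>R u \<in> L"
    and LF: "\<And>P. P \<in> L \<Longrightarrow> \<exists>s. P = F + s *\<^sub>R u"
  shows "\<not> tangent_line F b m L"
proof
  define \<beta> where "\<beta> = b \<bullet> u"
  have form: "conic_form F b m (F + s *\<^sub>R u) = (1 - \<beta>\<^sup>2) * s\<^sup>2 + 2 * m * \<beta> * s - m\<^sup>2" for s
    using u by (simp add: conic_form_def dist_norm \<beta>_def power2_eq_square algebra_simps)
  assume "tangent_line F b m L"
  then consider M where "tangent_at F b m L M" | "tangent_at_infinity F b m L"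
    by (auto simp: tangent_line_def)
  then show False
  proof cases
    case 1
    then obtain c where "M \<in> L" and c: "\<And>P. P \<in> L \<Longrightarrow> conic_form F b m P = c * (dist P M)\<^sup>2"
      by (auto simp: tangent_at_def)
    then obtain t where M: "M = F + t *\<^sub>R u" using LF by blast
    have "dist (F + s *\<^sub>R u) M = \<bar>s - t\<bar>" for s
      using u by (simp add: M dist_norm flip: scaleR_diff_left)
    then have "(1 - \<beta>\<^sup>2 - c) * s\<^sup>2 + (2 * m * \<beta> + 2 * c * t) * s + (- m\<^sup>2 - c * t\<^sup>2) = 0" for s
      using form[of s] c[OF L[of s]] by (simp add: power2_eq_square algebra_simps)
    note * = quadratic_vanishes[OF this]
    have "(m * \<beta>)\<^sup>2 = (c * t)\<^sup>2" using *(2) by (simp add: power2_eq_iff)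
    also have "\<dots> = c * (c * t\<^sup>2)" by (simp add: power2_eq_square)
    also have "\<dots> = (1 - \<beta>\<^sup>2) * (- m\<^sup>2)"
      using *(1,3) by (intro arg_cong2[where f = "(*)"]) simp_all
    finally have "m\<^sup>2 = 0" by (simp add: algebra_simps power_mult_distrib)
    then show False using assms(1) by simp
  next
    case 2
    then obtain c where c: "\<And>P. P \<in> L \<Longrightarrow> conic_form F b m P = c"
      by (auto simp: tangent_at_infinity_def)
    then have "(1 - \<beta>\<^sup>2) * s\<^sup>2 + (2 * m * \<beta>) * s + (- m\<^sup>2 - c) = 0" for s
      using form[of s] c[OF L[of s]] by simp
    note * = quadratic_vanishes[OF this]
    show False using *(1,2) assms(1) by auto
  qed
qed

lemma inner_mult_right_unit:
  fixes u w :: complex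
  assumes "norm u = 1"
  shows "u \<bullet> (w * u) = Re w"
proof -
  have "u \<bullet> (w * u) = Re w * (u \<bullet> u)"
    by (simp add: inner_complex_def algebra_simps)
  also have "u \<bullet> u = 1" using assms by (simp add: norm_eq_1)
  finally show ?thesis by simp
qed

section \<open>Polygons with their rays fixed, and the even case\<close>

locale focal_polygon =
  fixes F a :: complex and l :: real and n :: nat and V u :: "nat \<Rightarrow> complex" and z :: complex
  assumes n3: "3 \<le> n" and l0: "0 \<le> l" and Vn: "\<And>i. V (i + n) = V i"
    and inj: "inj_on V {..<n}" and on_conic: "\<And>i. V i \<in> conic F a l"
    and un: "\<And>i. u (i + n) = u i" and dir: "\<And>i. focal_direction F a l (V i) (u i)"
    and uS: "\<And>i. u (Suc i) = z * u i" and z: "norm z = 1"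
begin

lemma norm_u: "norm (u i) = 1"
  using dir[of i] by (simp add: focal_direction_def)

lemma u_add: "u (i + k) = z ^ k * u i"
  by (induction k) (simp_all add: uS)

lemma z_pow_n: "z ^ n = 1"
  using u_add[of 0 n] un[of 0] norm_u[of 0] by auto

lemma V_polar:
  obtains r where "r \<noteq> 0" "V i = F + r *\<^sub>R u i" "\<bar>r\<bar> = \<bar>l - r * (a \<bullet> u i)\<bar>"
    "0 < l \<Longrightarrow> r * (1 + a \<bullet> u i) = l"
proof -
  obtain r where r: "r \<noteq> 0" "V i = F + r *\<^sub>R u i" "l = 0 \<or> (0 < r \<longleftrightarrow> a \<bullet> (V i - F) < l)"
    using dir[of i] unfolding focal_direction_def by blast
  have abs: "\<bar>r\<bar> = \<bar>l - r * (a \<bullet> u i)\<bar>"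
    using on_conic[of i] norm_u[of i] by (simp add: conic_def r(2) dist_norm)
  moreover have "r * (1 + a \<bullet> u i) = l" if "0 < l"
  proof -
    have "0 < r \<longleftrightarrow> r * (a \<bullet> u i) < l" using r that by simp
    then show ?thesis using abs r(1) by (simp add: algebra_simps abs_if split: if_splits)
  qed
  ultimately show ?thesis using r that by blast
qed

lemma V_eq_mod: "V i = V (i mod n)"
proof -
  have "V (i + k * n) = V i" for i k
    by (induction k arbitrary: i) (simp_all add: Vn flip: add.assoc)
  from this[of "i mod n" "i div n"] show ?thesis by simp
qed

lemma V_neq:
  assumes "0 < k" "k < n"
  shows "V i \<noteq> V (i + k)"
proof
  assume "V i = V (i + k)"
  then have "V (i mod n) = V ((i + k) mod n)" using V_eq_mod by metis
  then have "i mod n = (i + k) mod n" using inj n3 by (auto dest!: inj_onD)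
  then have "n dvd k" by (metis add_diff_cancel_left' mod_eq_dvd_iff_nat le_add1)
  then show False using assms by (auto dest: dvd_imp_le)
qed

lemma focus_on_diagonal:
  assumes "even n"
  shows "F \<in> affine hull {V j, V (j + n div 2)}"
proof -
  define h where "h = n div 2"
  have h: "n = 2 * h" using assms by (simp add: h_def)
  have "(z ^ h)\<^sup>2 = 1" using z_pow_n h by (metis power_mult mult.commute)
  then have "z ^ h = 1 \<or> z ^ h = -1" by (simp add: power2_eq_1_iff)
  then have "u (j + h) = 1 *\<^sub>R u j \<or> u (j + h) = (-1) *\<^sub>R u j" by (auto simp: u_add)
  then obtain s :: real where s: "u (j + h) = s *\<^sub>R u j" by blast
  obtain r where r: "V j = F + r *\<^sub>R u j" using V_polar[of j] by blast
  obtain t where "V (j + h) = F + t *\<^sub>R u (j + h)" using V_polar[of "j + h"] by blast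
  then have t: "V (j + h) = F + (t * s) *\<^sub>R u j" by (simp add: s)
  \<comment> \<open>Both vertices lie on the line through \<open>F\<close> in direction
    \<open>u j\<close>; being distinct, they span it, whichever sign \<open>s\<close> has.\<close>
  have "V j \<noteq> V (j + h)" using n3 h by (intro V_neq) auto
  then have "r \<noteq> t * s" using r t by auto
  then show ?thesis
    using affine_hull_2_collinear[of r "t * s" F 0 "u j"] r t by (simp add: h_def)
qed

end

section \<open>The odd case: excluded rotations and degenerate conics\<close>

locale odd_circumscribed_polygon = focal_polygon +
  fixes b :: complex and m :: real
  assumes odd: "odd n" and m: "0 < m" and tangent: "\<And>i. tangent_line F b m (side V i)"
begin

text \<open>With \<open>z = 1\<close> the first two vertices share a ray, so their side passes
  through \<open>F\<close> and cannot be tangent.\<close>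

lemma z_neq_1: "z \<noteq> 1"
proof
  assume "z = 1"
  then have u1: "u 1 = u 0" using uS[of 0] by simp
  obtain r where r: "V 0 = F + r *\<^sub>R u 0" using V_polar[of 0] by blast
  obtain s where s: "V 1 = F + s *\<^sub>R u 0" using V_polar[of 1] u1 by metis
  have "V 0 \<noteq> V 1" using V_neq[of 1 0] n3 by simp
  then have rs: "r \<noteq> s" using r s by auto
  have "F + t *\<^sub>R u 0 \<in> side V 0" for t
    using affine_hull_2_collinear[OF rs] r s by (simp add: side_def)
  moreover have "\<exists>t. P = F + t *\<^sub>R u 0" if P: "P \<in> side V 0" for P
  proof -
    obtain p q where P': "P = p *\<^sub>R V 0 + q *\<^sub>R V 1" and pq: "p + q = 1"
      using P by (auto simp: side_def affine_hull_2)
    from P' have "P = (p + q) *\<^sub>R F + (p * r + q * s) *\<^sub>R u 0"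
      unfolding r s by (simp only: scaleR_add_left scaleR_add_right scaleR_scaleR ac_simps)
    then have "P = F + (p * r + q * s) *\<^sub>R u 0" by (simp only: pq scaleR_one)
    then show ?thesis ..
  qed
  ultimately show False
    using tangent_line_avoids_focus[OF m norm_u] tangent by blast
qed

lemma z_neq_minus_1: "z \<noteq> -1"
  using z_pow_n odd by auto

lemma z_square_neq_minus_1: "z\<^sup>2 \<noteq> -1"
proof
  assume *: "z\<^sup>2 = -1"
  have "z ^ (n * 2) = (-1) ^ n" using * by (metis power_mult mult.commute)
  moreover have "z ^ (n * 2) = 1" by (simp add: power_mult z_pow_n)
  ultimately show False using odd by simp
qed

lemma Im_z_neq_0: "Im z \<noteq> 0"
proof
  assume "Im z = 0"
  then have "\<bar>Re z\<bar> = 1" using z by (simp add: cmod_eq_Re)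
  then have "z = 1 \<or> z = -1" using \<open>Im z = 0\<close> by (auto simp: complex_eq_iff)
  then show False using z_neq_1 z_neq_minus_1 by auto
qed

text \<open>This is the characteristic equation of the rotation \<open>z\<close>; it yields a linear
  recurrence for three consecutive ray directions.\<close>

lemma z_square: "z\<^sup>2 = 2 * Re z * z - 1"
proof -
  have "z * z + 1 = z * z + z * cnj z"
    using z complex_norm_square[of z] by simp
  also have "\<dots> = z * (z + cnj z)" by (simp add: algebra_simps)
  finally show ?thesis by (simp add: complex_add_cnj power2_eq_square algebra_simps)
qed

text \<open>A degenerate conic consists of at most two lines through \<open>F\<close>, but \<open>u 0\<close>, \<open>u 1\<close>, \<open>u 2\<close>
  span three.\<close>

lemma l_pos: "0 < l"
proof (rule ccontr)
  assume "\<not> 0 < l"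
  then have l: "l = 0" using l0 by simp
  have abs: "\<bar>a \<bullet> u i\<bar> = 1" for i
  proof -
    obtain r where "r \<noteq> 0" "\<bar>r\<bar> = \<bar>l - r * (a \<bullet> u i)\<bar>" using V_polar[of i] by blast
    then show ?thesis by (simp add: l abs_mult)
  qed
  have "u 2 = z\<^sup>2 * u 0" using u_add[of 0 2] by (simp only: add_0)
  also have "\<dots> = (2 * Re z) *\<^sub>R u 1 - u 0"
    using uS[of 0] by (simp add: z_square algebra_simps scaleR_conv_of_real)
  finally have "a \<bullet> u 2 + a \<bullet> u 0 = 2 * Re z * (a \<bullet> u 1)" by (simp add: inner_diff_right)
  \<comment> \<open>All three inner products are \<open>1\<close> or \<open>-1\<close>, so the left
    side is \<open>0\<close>, \<open>2\<close> or \<open>-2\<close>.\<close>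
  then have "Re z = 0 \<or> \<bar>Re z\<bar> = 1"
    using abs[of 0] abs[of 1] abs[of 2] by (auto simp: abs_if split: if_splits)
  then show False
  proof
    assume "Re z = 0" then show False using z_square z_square_neq_minus_1 by simp
  next
    assume "\<bar>Re z\<bar> = 1"
    then have "(Re z)\<^sup>2 = 1" by (metis power2_abs one_power2)
    then show False using Im_z_neq_0 z by (simp add: cmod_def)
  qed
qed

section \<open>Poles of the opposite sides\<close>

definition h :: nat where "h = (n - 1) div 2"

lemma n_eq: "n = h + Suc h"
  using odd by (auto simp: h_def elim: oddE)

text \<open>Two unit numbers with product \<open>z ^ n = 1\<close> are conjugate. Hence the rays to
  the two ends of the side opposite to \<open>V j\<close> are mirror images in the axis
  \<open>u j\<close>.\<close>

lemma z_pow_Suc_h: "z ^ Suc h = cnj (z ^ h)"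
proof -
  have "z ^ h * z ^ Suc h = 1" using z_pow_n n_eq by (metis power_add)
  moreover have "z ^ h * cnj (z ^ h) = 1"
    using z complex_norm_square[of "z ^ h"] by (simp add: norm_power)
  moreover have "z ^ h \<noteq> 0" using z by auto
  ultimately show ?thesis by (metis mult_left_cancel)
qed

lemma z_pow_h_square: "z * (z ^ h)\<^sup>2 = 1"
proof -
  have "z ^ h * z ^ Suc h = 1" using z_pow_n n_eq by (metis power_add)
  then show ?thesis by (simp add: power2_eq_square algebra_simps)
qed

text \<open>The reciprocal of the cosine of the angle that \<open>u j\<close> makes with either ray
  to the opposite side.\<close>

definition \<kappa> :: real where "\<kappa> = 1 / Re (z ^ h)"

lemma Re_z_pow_h: "Re (z ^ h) \<noteq> 0"
proof
  assume "Re (z ^ h) = 0"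
  then have "z ^ Suc h = - (z ^ h)" unfolding z_pow_Suc_h
    by (simp add: complex_eq_iff del: complex_cnj_power)
  then have "z ^ h * (z + 1) = 0" by (simp add: algebra_simps)
  moreover have "z ^ h \<noteq> 0" using z by auto
  ultimately show False using z_neq_minus_1 by (simp add: add_eq_0_iff2)
qed

text \<open>This is what finally keeps the point of tangency apart from \<open>V j\<close>.\<close>

lemma kappa_neq_1: "\<kappa> \<noteq> 1"
proof
  assume "\<kappa> = 1"
  then have Re: "Re (z ^ h) = 1" by (simp add: \<kappa>_def)
  moreover have "norm (z ^ h) = 1" by (simp add: norm_power z)
  ultimately have "Im (z ^ h) = 0" by (simp add: cmod_def)
  with Re have "z ^ h = 1" by (simp add: complex_eq_iff)
  then show False using z_pow_h_square z_neq_1 by simp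
qed

definition pole :: "nat \<Rightarrow> complex" where "pole j = (a + \<kappa> *\<^sub>R u j) /\<^sub>R l"

text \<open>The assumptions give \<open>\<kappa> * (u j \<bullet> u k) = 1\<close>, which replaces
  the \<open>1\<close> in the polar equation \<open>r * (1 + a \<bullet> u k) = l\<close> and turns
  it into a linear one.\<close>

lemma pole_vertex:
  assumes "u k = w * u j" "Re w = Re (z ^ h)"
  shows "pole j \<bullet> (V k - F) = 1"
proof -
  obtain r where r: "V k = F + r *\<^sub>R u k" "0 < l \<Longrightarrow> r * (1 + a \<bullet> u k) = l" using V_polar[of k] by blast
  have "\<kappa> * (u j \<bullet> u k) = 1"
    using assms inner_mult_right_unit[OF norm_u, of j w] Re_z_pow_h by (simp add: \<kappa>_def)
  then have "(a + \<kappa> *\<^sub>R u j) \<bullet> (r *\<^sub>R u k) = r * (1 + a \<bullet> u k)"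
    by (simp add: inner_add_left algebra_simps)
  then show ?thesis using r l_pos by (simp add: pole_def divide_simps)
qed

definition opp_dir :: "nat \<Rightarrow> complex" where
  "opp_dir j = V (j + h + 1) - V (j + h)"

lemma opp_dir_nonzero: "opp_dir j \<noteq> 0"
  using V_neq[of 1 "j + h"] n3 by (auto simp: opp_dir_def)

lemma pole_opposite_vertices:
  "pole j \<bullet> (V (j + h) - F) = 1" "pole j \<bullet> (V (j + h + 1) - F) = 1"
proof -
  show "pole j \<bullet> (V (j + h) - F) = 1" using u_add by (intro pole_vertex) auto
  have "u (j + h + 1) = z ^ Suc h * u j" using u_add[of j "Suc h"] by simp
  \<comment> \<open>Conjugation keeps the real part, so the same \<open>\<kappa>\<close> serves the
    second endpoint.\<close>
  then have "u (j + h + 1) = cnj (z ^ h) * u j" by (simp only: z_pow_Suc_h)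
  then show "pole j \<bullet> (V (j + h + 1) - F) = 1" by (rule pole_vertex) (simp del: complex_cnj_power)
qed

lemma pole_opp_dir: "pole j \<bullet> opp_dir j = 0"
  using pole_opposite_vertices[of j] by (simp add: opp_dir_def inner_diff_right)

lemma pole_side:
  assumes "P \<in> side V (j + h)"
  shows "pole j \<bullet> (P - F) = 1"
proof -
  obtain p q where P: "P = p *\<^sub>R V (j + h) + q *\<^sub>R V (j + h + 1)" and pq: "p + q = 1"
    using assms by (auto simp: side_def affine_hull_2)
  have "P - F = p *\<^sub>R (V (j + h) - F) + q *\<^sub>R (V (j + h + 1) - F)"
    using pq by (simp add: P algebra_simps flip: scaleR_add_left)
  then show ?thesis using pq pole_opposite_vertices[of j] by (simp add: inner_add_right)
qed

lemma side_translate: "P \<in> side V (j + h) \<Longrightarrow> P + s *\<^sub>R opp_dir j \<in> side V (j + h)"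
  using affine_hull_2_translate by (simp add: side_def opp_dir_def)

section \<open>Directions of the points of tangency\<close>

definition tangency_dir :: "nat \<Rightarrow> complex" where
  "tangency_dir j = m *\<^sub>R pole j - b"

lemmas tangent_at_side = tangent_at_polar[OF _ pole_side side_translate opp_dir_nonzero
    pole_opp_dir tangency_dir_def]

lemma V_in_side: "V i \<in> side V i"
  by (simp add: side_def hull_inc)

lemmas tangent_at_infinity_side = tangent_at_infinity_polar[OF _ V_in_side pole_side
    side_translate opp_dir_nonzero pole_opp_dir tangency_dir_def]

lemma norm_tangency_dir: "norm (tangency_dir j) = 1"
proof -
  consider M where "tangent_at F b m (side V (j + h)) M"
    | "tangent_at_infinity F b m (side V (j + h))"
    using tangent[of "j + h"] by (auto simp: tangent_line_def)
  then show ?thesis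
    by cases (blast elim: tangent_at_side, blast elim: tangent_at_infinity_side)
qed

text \<open>All \<open>\<beta> + \<gamma> *\<^sub>R u j\<close> are unit vectors, so
  \<open>\<beta> \<bullet> u j\<close> is constant. Thus \<open>\<beta>\<close> is orthogonal to the
  independent differences \<open>u 1 - u 0\<close> and \<open>u 2 - u 1\<close>, and
  vanishes.\<close>

lemma tangency_dir_eq:
  obtains \<gamma> :: real where "\<And>j. tangency_dir j = \<gamma> *\<^sub>R u j"
proof -
  define \<beta> where "\<beta> = (m / l) *\<^sub>R a - b"
  define \<gamma> where "\<gamma> = m * \<kappa> / l"
  have eq: "tangency_dir j = \<beta> + \<gamma> *\<^sub>R u j" for j
    by (simp add: tangency_dir_def pole_def \<beta>_def \<gamma>_def algebra_simps divide_inverse)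
  have "\<gamma> \<noteq> 0" using m l_pos Re_z_pow_h by (simp add: \<gamma>_def \<kappa>_def)
  have "\<beta> \<bullet> \<beta> + \<gamma>\<^sup>2 + 2 * \<gamma> * (\<beta> \<bullet> u j) = 1" for j
  proof -
    have "(\<beta> + \<gamma> *\<^sub>R u j) \<bullet> (\<beta> + \<gamma> *\<^sub>R u j) = 1"
      using norm_tangency_dir[of j] by (simp add: eq norm_eq_1)
    moreover have "u j \<bullet> u j = 1" using norm_u by (simp add: norm_eq_1)
    ultimately show ?thesis
      by (simp add: inner_add_left inner_add_right inner_commute power2_eq_square algebra_simps)
  qed
  then have const: "\<beta> \<bullet> u j = \<beta> \<bullet> u 0" for j
    using \<open>\<gamma> \<noteq> 0\<close> by (smt (verit) mult_left_cancel mult_eq_0_iff)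
  define p where "p = u 1 - u 0"
  \<comment> \<open>A quarter turn of \<open>p\<close>: orthogonal to \<open>p\<close>, but not to
    \<open>z * p\<close> because \<open>Im z \<noteq> 0\<close>.\<close>
  define q where "q = \<i> * p"
  have p: "p = (z - 1) * u 0" using uS[of 0] by (simp add: p_def algebra_simps)
  have p0: "p \<noteq> 0" using p z_neq_1 norm_u[of 0] by auto
  have zp: "z * p = u 2 - u 1"
    using uS[of 0] uS[of 1] by (simp add: p_def numeral_2_eq_2 algebra_simps)
  have "q \<bullet> (z * p) = Im z * (p \<bullet> p)"
    by (simp add: q_def inner_complex_def algebra_simps)
  then have "q \<bullet> (z * p) \<noteq> 0" using Im_z_neq_0 p0 by simp
  moreover have "q \<bullet> p = 0" by (simp add: q_def inner_complex_def)
  moreover have "\<beta> \<bullet> p = 0" "\<beta> \<bullet> (z * p) = 0"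
    unfolding zp unfolding p_def using const[of 1] const[of 2] by (simp_all add: inner_diff_right)
  ultimately have "\<beta> = 0" using complex_orthogonal_to_basis[of \<beta> "z * p" p q] p0 by blast
  then show ?thesis using that[of \<gamma>] eq by simp
qed

text \<open>\<open>V j\<close> and \<open>M\<close> both lie on the line through \<open>F\<close> in
  direction \<open>u j\<close>. They are distinct because their polar equations differ only in
  \<open>1\<close> versus \<open>\<kappa>\<close>.\<close>

lemma focus_on_chord:
  assumes "tangent_at F b m (side V (j + h)) M"
  shows "F \<in> affine hull {V j, M}"
proof -
  obtain k where k: "M - F = k *\<^sub>R tangency_dir j" using assms by (rule tangent_at_side)
  obtain \<gamma> where g: "\<And>j. tangency_dir j = \<gamma> *\<^sub>R u j" using tangency_dir_eq by blast
  define s where "s = k * \<gamma>"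
  have M: "M = F + s *\<^sub>R u j" using k g by (simp add: s_def algebra_simps)
  have "pole j \<bullet> (M - F) = 1" using assms pole_side by (auto simp: tangent_at_def)
  moreover have "u j \<bullet> u j = 1" using norm_u by (simp add: norm_eq_1)
  ultimately have sl: "s * (\<kappa> + a \<bullet> u j) = l"
    using l_pos by (simp add: M pole_def inner_add_left field_simps)
  obtain r where r: "r \<noteq> 0" "V j = F + r *\<^sub>R u j" "0 < l \<Longrightarrow> r * (1 + a \<bullet> u j) = l"
    using V_polar[of j] by blast
  have "r \<noteq> s"
  proof
    assume "r = s"
    then have "r * \<kappa> = r" using sl r(3)[OF l_pos] by (simp only: distrib_left)
    then show False using r(1) kappa_neq_1 by simp
  qed
  then show ?thesis using affine_hull_2_collinear[of r s F 0 "u j"] r M by simp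
qed

text \<open>When the point of tangency is at infinity, the chord becomes the parallel to the side
  through \<open>V j\<close>; its direction is again a multiple of \<open>u j\<close>.\<close>

lemma focus_on_parallel:
  assumes "tangent_at_infinity F b m (side V (j + h))"
  shows "\<exists>t::real. F = V j + t *\<^sub>R opp_dir j"
proof -
  obtain k where k: "opp_dir j = k *\<^sub>R tangency_dir j"
    using assms by (rule tangent_at_infinity_side)
  obtain \<gamma> where g: "\<And>j. tangency_dir j = \<gamma> *\<^sub>R u j" using tangency_dir_eq by blast
  have d: "opp_dir j = (k * \<gamma>) *\<^sub>R u j" using k g by simp
  then have "k * \<gamma> \<noteq> 0" using opp_dir_nonzero[of j] by auto
  obtain r where "V j = F + r *\<^sub>R u j" using V_polar[of j] by blast
  then have "F = V j + (- r / (k * \<gamma>)) *\<^sub>R opp_dir j"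
    using \<open>k * \<gamma> \<noteq> 0\<close> by (simp add: d)
  then show ?thesis ..
qed

end

theorem theorem3:
  fixes F a :: complex and l :: real and n :: nat and V :: "nat \<Rightarrow> complex"
  assumes "discrete_conic F a l n V"
  shows "(even n \<longrightarrow> (\<forall>j. F \<in> affine hull {V j, V (j + n div 2)})) \<and>
    (odd n \<longrightarrow>
      (\<forall>(b::complex) (m::real).
        0 < m \<and> (\<forall>i. tangent_line F b m (side V i)) \<longrightarrow>
        (\<forall>j. (\<forall>M. tangent_at F b m (side V (j + (n - 1) div 2)) M \<longrightarrow>
                F \<in> affine hull {V j, M}) \<and>
             (tangent_at_infinity F b m (side V (j + (n - 1) div 2)) \<longrightarrow>
                (\<exists>t::real. F = V j + t *\<^sub>R (V (j + (n - 1) div 2 + 1) - V (j + (n - 1) div 2)))))))"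
proof -
  obtain \<theta> u where u: "\<And>i. u (i + n) = u i" "\<And>i. focal_direction F a l (V i) (u i)"
    "\<And>i. u (i + 1) = cis \<theta> * u i"
    using assms unfolding discrete_conic_def by blast
  interpret focal_polygon F a l n V u "cis \<theta>"
    using assms u by unfold_locales (auto simp: discrete_conic_def)
  show ?thesis
  \<comment> \<open>The goals are the even case, a finite point of tangency, and a side that is an
    asymptote.\<close>
  proof (intro conjI impI allI, goal_cases)
    case (1 j)
    then show ?case by (rule focus_on_diagonal)
  next
    case (2 b m j M)
    then interpret odd_circumscribed_polygon F a l n V u "cis \<theta>" b m
      by unfold_locales auto
    show ?case using 2 focus_on_chord[of j M] by (simp add: h_def)
  next
    case (3 b m j)
    then interpret odd_circumscribed_polygon F a l n V u "cis \<theta>" b m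
      by unfold_locales auto
    show ?case using 3 focus_on_parallel[of j] by (simp add: h_def opp_dir_def)
  qed
qed

end
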